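(* Let $Y$ be a Banach space and let $\{X_n\}_{n\in\mathbb{N}}$ and $X$ be closed subspaces of $Y$. If $X_n\to X$ in the operator opening topology, i.e. $\lim_{n\to\infty} r(X_n,X)=0$, then $$\lim_{n\to\infty} n(X_n)=n(X).$$
   Context: Banach spaces are over $\mathbb{K}$ ($\mathbb{R}$ or $\mathbb{C}$). For a Banach space $E$, $\mathcal{L}(E)$ denotes the bounded linear operators on $E$, $S_E$ the unit sphere, $E^*$ the dual space. Numerical radius and index: for $T\in\mathcal{L}(E)$, the numerical radius is $$v(T)=\sup\{|x^*(Tx)| : x\in S_E,\ x^*\in S_{E^*},\ x^*(x)=1\},$$ and the numerical index of $E$ is $$n(E)=\inf\{v(T): T\in\mathcal{L}(E),\ \|T\|=1\}.$$ Operator opening: let $GL(Y)$ be the group of all invertible (bounded, with bounded inverse) linear operators on the Banach space $Y$, and $I$ the identity operator on $Y$. For closed subspaces $W,Z$ of $Y$ put $$r_0(W,Z)=\inf\{\|C-I\| : C\in GL(Y),\ C(W)=Z\}$$ if the set over which the infimum is taken is nonempty, and $r_0(W,Z)=1$ otherwise. The operator opening between $W$ and $Z$ is $r(W,Z)=\max\{r_0(W,Z),r_0(Z,W)\}$. Convergence $X_n\to X$ in the operator opening topology means $r(X_n,X)\to 0$. *)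

theory Defs
  imports "HOL-Analysis.Analysis"
begin

text \<open>
  The scalar field: up to isometric isomorphism, the types of this class are exactly the
  real and the complex numbers.
\<close>

class real_or_complex = real_normed_field +
  assumes isometric_to_Reals_or_complex:
    "\<exists>\<phi> :: 'a \<Rightarrow> complex.
       (\<forall>a b. \<phi> (a + b) = \<phi> a + \<phi> b \<and> \<phi> (a * b) = \<phi> a * \<phi> b) \<and>
       (\<forall>a. norm (\<phi> a) = norm a) \<and> (range \<phi> = \<real> \<or> range \<phi> = UNIV)"

instance real :: real_or_complex
proof
  show "\<exists>\<phi> :: real \<Rightarrow> complex.
       (\<forall>a b. \<phi> (a + b) = \<phi> a + \<phi> b \<and> \<phi> (a * b) = \<phi> a * \<phi> b) \<and>
       (\<forall>a. norm (\<phi> a) = norm a) \<and> (range \<phi> = \<real> \<or> range \<phi> = UNIV)"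
    by (rule exI[of _ of_real]) (simp add: Reals_def)
qed

instance complex :: real_or_complex
proof
  show "\<exists>\<phi> :: complex \<Rightarrow> complex.
       (\<forall>a b. \<phi> (a + b) = \<phi> a + \<phi> b \<and> \<phi> (a * b) = \<phi> a * \<phi> b) \<and>
       (\<forall>a. norm (\<phi> a) = norm a) \<and> (range \<phi> = \<real> \<or> range \<phi> = UNIV)"
    by (rule exI[of _ "\<lambda>z. z"]) simp
qed

text \<open>
  The library's class \<^class>\<open>banach\<close> only provides real scalars. A Banach space over
  \<open>'k\<close> is a real Banach space with a compatible multiplication by scalars in \<open>'k\<close>
  for which the norm is homogeneous.
\<close>

locale banach_over = vector_space smul
  for smul :: "'k::real_or_complex \<Rightarrow> 'a::banach \<Rightarrow> 'a" +
  assumes smul_of_real: "smul (of_real t) x = t *\<^sub>R x"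
    and norm_smul: "norm (smul c x) = norm c * norm x"

definition closed_subspace :: "('k::real_or_complex \<Rightarrow> 'a::banach \<Rightarrow> 'a) \<Rightarrow> 'a set \<Rightarrow> bool"
  where "closed_subspace smul W \<longleftrightarrow> module.subspace smul W \<and> closed W"

text \<open>
  A map on a subspace \<open>W\<close> is represented by a total function of which only the values
  on \<open>W\<close> matter.
\<close>

definition bounded_linear_on ::
    "('k::real_or_complex \<Rightarrow> 'a::real_normed_vector \<Rightarrow> 'a) \<Rightarrow>
     ('k \<Rightarrow> 'b::real_normed_vector \<Rightarrow> 'b) \<Rightarrow> 'a set \<Rightarrow> ('a \<Rightarrow> 'b) \<Rightarrow> bool"
  where "bounded_linear_on s1 s2 W f \<longleftrightarrow>
    (\<forall>x\<in>W. \<forall>y\<in>W. f (x + y) = f x + f y) \<and>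
    (\<forall>c. \<forall>x\<in>W. f (s1 c x) = s2 c (f x)) \<and>
    (\<exists>B. \<forall>x\<in>W. norm (f x) \<le> B * norm x)"

text \<open>As in \<^const>\<open>onorm\<close>, the quotient is 0 at \<open>x = 0\<close>.\<close>

definition onorm_on :: "'a::real_normed_vector set \<Rightarrow> ('a \<Rightarrow> 'b::real_normed_vector) \<Rightarrow> real"
  where "onorm_on W f = (SUP x\<in>W. norm (f x) / norm x)"

definition operators_on :: "('k::real_or_complex \<Rightarrow> 'a::banach \<Rightarrow> 'a) \<Rightarrow> 'a set \<Rightarrow> ('a \<Rightarrow> 'a) set"
  where "operators_on smul W = {T. bounded_linear_on smul smul W T \<and> T ` W \<subseteq> W}"

definition dual_on :: "('k::real_or_complex \<Rightarrow> 'a::banach \<Rightarrow> 'a) \<Rightarrow> 'a set \<Rightarrow> ('a \<Rightarrow> 'k) set"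
  where "dual_on smul W = {f. bounded_linear_on smul (*) W f}"

definition numerical_radius ::
    "('k::real_or_complex \<Rightarrow> 'a::banach \<Rightarrow> 'a) \<Rightarrow> 'a set \<Rightarrow> ('a \<Rightarrow> 'a) \<Rightarrow> real"
  where "numerical_radius smul W T =
    Sup {norm (f (T x)) | x f. x \<in> W \<and> norm x = 1 \<and> f \<in> dual_on smul W \<and> onorm_on W f = 1 \<and> f x = 1}"

text \<open>
  For \<open>W = {0}\<close> no operator has norm 1, and the value is the unspecified real number
  \<open>Inf {}\<close>. This is harmless for limits in the operator opening: \<open>{0}\<close> is at
  opening 1 from every other subspace.
\<close>

definition numerical_index :: "('k::real_or_complex \<Rightarrow> 'a::banach \<Rightarrow> 'a) \<Rightarrow> 'a set \<Rightarrow> real"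
  where "numerical_index smul W =
    Inf {numerical_radius smul W T | T. T \<in> operators_on smul W \<and> onorm_on W T = 1}"

definition GL :: "('k::real_or_complex \<Rightarrow> 'a::banach \<Rightarrow> 'a) \<Rightarrow> ('a \<Rightarrow> 'a) set"
  where "GL smul =
    {C. Vector_Spaces.linear smul smul C \<and> bounded_linear C \<and> bij C \<and> bounded_linear (inv C)}"

definition opening0 :: "('k::real_or_complex \<Rightarrow> 'a::banach \<Rightarrow> 'a) \<Rightarrow> 'a set \<Rightarrow> 'a set \<Rightarrow> real"
  where "opening0 smul W Z =
    (if \<exists>C\<in>GL smul. C ` W = Z
     then Inf {onorm (\<lambda>x. C x - x) | C. C \<in> GL smul \<and> C ` W = Z}
     else 1)"

definition operator_opening ::
    "('k::real_or_complex \<Rightarrow> 'a::banach \<Rightarrow> 'a) \<Rightarrow> 'a set \<Rightarrow> 'a set \<Rightarrow> real"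
  where "operator_opening smul W Z = max (opening0 smul W Z) (opening0 smul Z W)"

end

theory Submission imports Defs "HOL-Real_Asymp.Real_Asymp" begin

text \<open>
  Norming functionals give \<open>\<parallel>(I - sT)x\<parallel> \<ge> (1 - \<bar>s\<bar> v(T)) \<parallel>x\<parallel>\<close>. Applied to \<open>(I + sT)x\<close>, this shows
  \<open>\<parallel>I + sT\<parallel> \<le> (1 + t\<^sup>2) / (1 - t v(T))\<close> for \<open>\<parallel>T\<parallel> = 1\<close> and \<open>\<bar>s\<bar> = t\<close>. Conversely,
  \<open>v(T) \<le> (\<parallel>I + sT\<parallel> - 1) / t\<close> for a suitable choice of the phase of \<open>s\<close> at each state. So \<open>v(T)\<close>
  is read off from the operator norms \<open>\<parallel>I + sT\<parallel>\<close> with an error of order \<open>t\<close>, uniformly in \<open>T\<close>.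
  If \<open>C(W) = Z\<close> and \<open>\<parallel>C - I\<parallel> \<le> t\<^sup>2\<close>, conjugation by \<open>C\<close> changes these operator norms by a
  factor \<open>1 + O(t\<^sup>2)\<close>, hence the quotient by \<open>O(t)\<close>, and the numerical indices of \<open>W\<close> and \<open>Z\<close>
  differ by \<open>O(t)\<close>.
\<close>

section \<open>Norming functionals\<close>

definition sublinear :: "('a::real_vector \<Rightarrow> real) \<Rightarrow> bool"
  where "sublinear q \<longleftrightarrow>
    (\<forall>x y. q (x + y) \<le> q x + q y) \<and> (\<forall>t\<ge>0. \<forall>x. q (t *\<^sub>R x) = t * q x)"

lemma sublinear_add: "sublinear q \<Longrightarrow> q (x + y) \<le> q x + q y"
  and sublinear_scaleR: "sublinear q \<Longrightarrow> t \<ge> 0 \<Longrightarrow> q (t *\<^sub>R x) = t * q x"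
  by (auto simp: sublinear_def)

lemma sublinear_zero: "sublinear q \<Longrightarrow> q 0 = 0"
  using sublinear_scaleR[of q 0 0] by simp

lemma sublinear_minus: "sublinear q \<Longrightarrow> - q (- x) \<le> q x"
  using sublinear_add[of q x "- x"] sublinear_zero[of q] by simp

lemma sublinear_norm: "sublinear norm"
  by (simp add: sublinear_def norm_triangle_ineq)

text \<open>
  A sublinear functional that is minimal equals all its descents, which makes it additive;
  the descent of the norm at \<open>x\<close> takes a value \<open>\<le> - \<parallel>x\<parallel>\<close> at \<open>- x\<close>, which forces
  a linear functional below it to be norming at \<open>x\<close>.
\<close>

definition descend :: "'a::real_vector \<Rightarrow> ('a \<Rightarrow> real) \<Rightarrow> 'a \<Rightarrow> real"
  where "descend y q x = (INF s\<in>{0..}. q (x + s *\<^sub>R y) - s * q y)"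

lemma descend_le:
  assumes "sublinear q" "s \<ge> 0"
  shows "descend y q x \<le> q (x + s *\<^sub>R y) - s * q y"
  unfolding descend_def
proof (rule cINF_lower)
  show "bdd_below ((\<lambda>s. q (x + s *\<^sub>R y) - s * q y) ` {0..})"
  proof (rule bdd_belowI2)
    \<comment> \<open>Writing \<open>s *\<^sub>R y\<close> as the sum of
      \<open>x + s *\<^sub>R y\<close> and \<open>- x\<close> gives a lower bound independent of
      \<open>s\<close>, so the infimum is a genuine real infimum.\<close>
    fix s :: real assume "s \<in> {0..}"
    then show "- q (- x) \<le> q (x + s *\<^sub>R y) - s * q y"
      using sublinear_add[OF assms(1), of "x + s *\<^sub>R y" "- x"] sublinear_scaleR[OF assms(1), of s y]
      by simp
  qed
qed (use assms in simp)

lemma descend_greatest: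
  assumes "\<And>s. s \<ge> 0 \<Longrightarrow> c \<le> q (x + s *\<^sub>R y) - s * q y"
  shows "c \<le> descend y q x"
  unfolding descend_def by (rule cINF_greatest) (use assms in auto)

lemma sublinear_descend:
  assumes q: "sublinear q"
  shows "sublinear (descend y q)"
  unfolding sublinear_def
proof (intro conjI allI impI)
  fix x z
  \<comment> \<open>Parameters \<open>r\<close> for \<open>x\<close> and \<open>s\<close> for
    \<open>z\<close> combine to \<open>r + s\<close> for \<open>x + z\<close>. The two infima are
    taken one after the other, first over \<open>r\<close>, then over \<open>s\<close>.\<close>
  have "descend y q (x + z) - (q (z + s *\<^sub>R y) - s * q y) \<le> descend y q x" if s: "s \<ge> 0" for s
  proof (rule descend_greatest)
    fix r :: real assume r: "r \<ge> 0"
    have "q (x + z + (r + s) *\<^sub>R y) \<le> q (x + r *\<^sub>R y) + q (z + s *\<^sub>R y)"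
      using sublinear_add[OF q, of "x + r *\<^sub>R y" "z + s *\<^sub>R y"] by (simp add: algebra_simps)
    then show "descend y q (x + z) - (q (z + s *\<^sub>R y) - s * q y) \<le> q (x + r *\<^sub>R y) - r * q y"
      using descend_le[OF q, of "r + s" y "x + z"] r s by (simp add: algebra_simps)
  qed
  then have "descend y q (x + z) - descend y q x \<le> descend y q z"
    by (intro descend_greatest) (simp add: algebra_simps)
  then show "descend y q (x + z) \<le> descend y q x + descend y q z" by simp
next
  fix t :: real and x :: 'a assume t: "t \<ge> 0"
  \<comment> \<open>One inequality for positive factors suffices: applied with
    \<open>inverse t\<close> at \<open>t *\<^sub>R x\<close> it becomes the reverse one.\<close>
  have le: "descend y q (t *\<^sub>R x) \<le> t * descend y q x" if t: "t > 0" for t x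
  proof -
    have "descend y q (t *\<^sub>R x) / t \<le> descend y q x"
    proof (rule descend_greatest)
      fix s :: real assume s: "s \<ge> 0"
      have "q (t *\<^sub>R x + (t * s) *\<^sub>R y) = t * q (x + s *\<^sub>R y)"
        using sublinear_scaleR[OF q, of t "x + s *\<^sub>R y"] t by (simp add: algebra_simps)
      then show "descend y q (t *\<^sub>R x) / t \<le> q (x + s *\<^sub>R y) - s * q y"
        using descend_le[OF q, of "t * s" y "t *\<^sub>R x"] t s by (simp add: field_simps)
    qed
    then show ?thesis using t by (simp add: field_simps)
  qed
  have zero: "descend y q 0 = 0"
  proof (rule antisym)
    show "descend y q 0 \<le> 0"
      using descend_le[OF q, of 0 y 0] sublinear_zero[OF q] by simp
    show "0 \<le> descend y q 0"
      by (rule descend_greatest) (simp add: sublinear_scaleR[OF q])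
  qed
  show "descend y q (t *\<^sub>R x) = t * descend y q x"
  proof (cases "t = 0")
    case False
    then have "t > 0" using t by simp
    then show ?thesis
      using le[of t x] le[of "inverse t" "t *\<^sub>R x"] by (simp add: field_simps)
  qed (simp add: zero)
qed

section \<open>Hahn-Banach by minimality\<close>

text \<open>Zorn's lemma on the sublinear functionals below \<open>p\<close>; the pointwise infimum
  of a nonempty chain is again one of them.\<close>

lemma minimal_sublinear_below:
  fixes p :: "'a::real_vector \<Rightarrow> real"
  assumes p: "sublinear p"
  shows "\<exists>q. sublinear q \<and> (\<forall>x. q x \<le> p x) \<and> (\<forall>r. sublinear r \<longrightarrow> (\<forall>x. r x \<le> q x) \<longrightarrow> r = q)"
proof -
  define A where "A = {q. sublinear q \<and> (\<forall>x. q x \<le> p x)}"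
  \<comment> \<open>The pointwise order is reversed, so the maximal elements given by Zorn are
    minimal functionals.\<close>
  define P where "P = (\<lambda>f g :: 'a \<Rightarrow> real. \<forall>x. g x \<le> f x)"
  have "\<exists>m\<in>A. \<forall>a\<in>A. P m a \<longrightarrow> a = m"
  proof (rule predicate_Zorn)
    show "partial_order_on A (relation_of P A)"
      by (auto simp: partial_order_on_def preorder_on_def refl_on_def trans_def antisym_def
          relation_of_def P_def fun_eq_iff intro: order_trans order.antisym)
    fix C assume C: "C \<in> Chains (relation_of P A)"
    then have sub: "C \<subseteq> A" by (auto simp: Chains_def relation_of_def)
    have cmp: "P f g \<or> P g f" if "f \<in> C" "g \<in> C" for f g
      using C that by (auto simp: Chains_def relation_of_def)
    show "\<exists>u\<in>A. \<forall>a\<in>C. P a u"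
    proof (cases "C = {}")
      case True
      then show ?thesis using p by (auto simp: A_def)
    next
      case False
      define u where "u x = (INF f\<in>C. f x)" for x
      \<comment> \<open>A bound common to the whole chain keeps the pointwise infimum
        \<open>u\<close> finite.\<close>
      have low: "- p (- x) \<le> f x" if "f \<in> C" for f x
        using that sub sublinear_minus[of f x] by (auto simp: A_def dest!: spec[of _ "- x"])
      have u_le: "u x \<le> f x" if "f \<in> C" for f x
        unfolding u_def using that by (intro cINF_lower bdd_belowI2[of _ "- p (- x)"]) (auto intro: low)
      have u_ge: "c \<le> u x" if "\<And>f. f \<in> C \<Longrightarrow> c \<le> f x" for c x
        unfolding u_def using that False by (intro cINF_greatest) auto
      have sl: "sublinear f" if "f \<in> C" for f using that sub by (auto simp: A_def)
      have "sublinear u"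
        unfolding sublinear_def
      proof (intro conjI allI impI)
        fix x y
        \<comment> \<open>The smaller of \<open>f\<close> and \<open>g\<close>, which exists in a
          chain, is used at both points: its own subadditivity bounds
          \<open>u (x + y)\<close>.\<close>
        have *: "u (x + y) \<le> f x + g y" if "f \<in> C" "g \<in> C" for f g
          using cmp[OF that] u_le[OF that(1), of "x + y"] u_le[OF that(2), of "x + y"]
            sublinear_add[OF sl[OF that(1)], of x y] sublinear_add[OF sl[OF that(2)], of x y]
          unfolding P_def by (smt (verit))
        have "u (x + y) - g y \<le> u x" if "g \<in> C" for g
          by (rule u_ge) (use * that in \<open>auto simp: algebra_simps\<close>)
        then have "u (x + y) - u x \<le> u y"
          by (intro u_ge) (auto simp: algebra_simps)
        then show "u (x + y) \<le> u x + u y" by simp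
      next
        fix t :: real and x :: 'a assume t: "t \<ge> 0"
        show "u (t *\<^sub>R x) = t * u x"
        proof (cases "t = 0")
          case True
          then show ?thesis using False sl by (simp add: u_def sublinear_zero cong: INF_cong_simp)
        next
          case pos: False
          have "u (t *\<^sub>R x) / t \<le> u x"
            by (rule u_ge) (use u_le[of _ "t *\<^sub>R x"] t pos sl in \<open>auto simp: sublinear_scaleR field_simps\<close>)
          moreover have "t * u x \<le> u (t *\<^sub>R x)"
            by (rule u_ge) (use u_le t pos sl in \<open>auto simp: sublinear_scaleR\<close>)
          ultimately show ?thesis using t pos by (simp add: field_simps)
        qed
      qed
      moreover have "u x \<le> p x" for x
        using False sub u_le by (force simp: A_def intro: order_trans)
      ultimately show ?thesis using u_le by (auto simp: A_def P_def)
    qed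
  qed
  then obtain m where "m \<in> A" "\<And>a. a \<in> A \<Longrightarrow> P m a \<Longrightarrow> a = m" by blast
  then show ?thesis
    by (intro exI[of _ m]) (auto simp: A_def P_def intro: order_trans)
qed

lemma hahn_banach_sublinear:
  fixes p :: "'a::real_vector \<Rightarrow> real"
  assumes "sublinear p"
  shows "\<exists>f. linear f \<and> (\<forall>x. f x \<le> p x)"
proof -
  obtain q where q: "sublinear q" "\<And>x. q x \<le> p x"
    and min: "\<And>r. sublinear r \<Longrightarrow> (\<And>x. r x \<le> q x) \<Longrightarrow> r = q"
    using minimal_sublinear_below[OF assms] by blast
  have add: "q (x + y) = q x + q y" for x y
  proof -
    \<comment> \<open>The parameter 0 puts the descent below \<open>q\<close>, and minimality forces
      equality. The parameter 1 then yields superadditivity of \<open>q\<close>.\<close>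
    have "descend y q = q"
      using descend_le[OF q(1), of 0] by (intro min sublinear_descend q(1)) simp
    then have "q x \<le> q (x + y) - q y"
      using descend_le[OF q(1), of 1 y x] by simp
    then show ?thesis using sublinear_add[OF q(1), of x y] by simp
  qed
  have neg: "q (- x) = - q x" for x
    using add[of x "- x"] sublinear_zero[OF q(1)] by simp
  have "linear q"
  proof (rule linearI)
    fix t x show "q (t *\<^sub>R x) = t *\<^sub>R q x"
      using sublinear_scaleR[OF q(1), of t x] sublinear_scaleR[OF q(1), of "- t" x] neg[of "t *\<^sub>R x"]
      by (cases "t \<ge> 0") auto
  qed (rule add)
  then show ?thesis using q(2) by blast
qed

lemma real_norming_functional:
  fixes x :: "'a::real_normed_vector"
  shows "\<exists>f. linear f \<and> (\<forall>y. \<bar>f y\<bar> \<le> norm y) \<and> f x = norm x"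
proof -
  obtain f where f: "linear f" and le: "\<And>y. f y \<le> descend x norm y"
    using hahn_banach_sublinear[OF sublinear_descend[OF sublinear_norm]] by metis
  have le_norm: "f y \<le> norm y" for y
    using le[of y] descend_le[OF sublinear_norm, of 0 x y] by simp
  moreover have "- f y \<le> norm y" for y
    using le_norm[of "- y"] by (simp add: linear_neg[OF f])
  moreover have "f (- x) \<le> - norm x"
    using le[of "- x"] descend_le[OF sublinear_norm, of 1 x "- x"] by simp
  ultimately show ?thesis
    using f by (intro exI[of _ f]) (auto simp: abs_le_iff linear_neg[OF f] intro!: antisym)
qed

section \<open>Norming functionals over real or complex scalars\<close>

text \<open>Pulls the real/complex alternative back along the isometry, as an imaginary unit with
  the Euclidean norm inside \<open>'k\<close> itself. This is what complexifying a real functional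
  requires.\<close>

lemma scalar_cases:
  "(\<forall>c::'k::real_or_complex. \<exists>a. c = of_real a) \<or>
   (\<exists>i::'k. i * i = - 1 \<and> (\<forall>c. \<exists>a b. c = of_real a + of_real b * i) \<and>
      (\<forall>a b. (norm (of_real a + of_real b * i))\<^sup>2 = a\<^sup>2 + b\<^sup>2))"
proof -
  obtain \<phi> :: "'k \<Rightarrow> complex" where add: "\<And>a b. \<phi> (a + b) = \<phi> a + \<phi> b"
    and mult: "\<And>a b. \<phi> (a * b) = \<phi> a * \<phi> b"
    and norm: "\<And>a. norm (\<phi> a) = norm a" and range: "range \<phi> = \<real> \<or> range \<phi> = UNIV"
    using isometric_to_Reals_or_complex by metis
  have zero: "\<phi> 0 = 0" using norm[of 0] by simp
  have minus: "\<phi> (- a) = - \<phi> a" for a using add[of a "- a"] zero by (simp add: add_eq_0_iff)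
  have diff: "\<phi> (a - b) = \<phi> a - \<phi> b" for a b using add[of a "- b"] minus[of b] by simp
  have inj: "a = b" if "\<phi> a = \<phi> b" for a b using norm[of "a - b"] that by (simp add: diff)
  have one: "\<phi> 1 = 1" using mult[of 1 1] norm[of 1] by auto
  \<comment> \<open>A complex number is determined to be \<open>r\<close> by its distances to 0 and 1.\<close>
  have real: "\<phi> (of_real r) = of_real r" for r
  proof -
    have 1: "cmod (\<phi> (of_real r)) = \<bar>r\<bar>" using norm[of "of_real r"] by simp
    have "cmod (\<phi> (of_real r) - 1) = norm (of_real (r - 1) :: 'k)"
      using norm[of "of_real r - 1"] by (simp add: diff one)
    then have 2: "cmod (\<phi> (of_real r) - 1) = \<bar>r - 1\<bar>" by (simp only: norm_of_real)
    have 3: "(Re (\<phi> (of_real r)))\<^sup>2 + (Im (\<phi> (of_real r)))\<^sup>2 = r\<^sup>2"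
      using arg_cong[OF 1, of power2] by (simp add: cmod_power2)
    have "(Re (\<phi> (of_real r)) - 1)\<^sup>2 + (Im (\<phi> (of_real r)))\<^sup>2 = (r - 1)\<^sup>2"
      using arg_cong[OF 2, of power2] by (simp add: cmod_power2)
    then have "Re (\<phi> (of_real r)) = r" using 3 by (simp add: power2_eq_square algebra_simps)
    then show ?thesis using 3 by (simp add: complex_eq_iff)
  qed
  from range show ?thesis
  proof
    assume "range \<phi> = \<real>"
    then have "\<exists>a. c = of_real a" for c :: 'k
      using real inj by (metis Reals_cases rangeI)
    then show ?thesis by blast
  next
    assume surj: "range \<phi> = UNIV"
    then obtain i where i: "\<phi> i = \<i>" by (metis surjD)
    have rep: "\<phi> (of_real a + of_real b * i) = Complex a b" for a b
      by (simp add: add mult real i complex_eq_iff)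
    have "i * i = - 1" by (rule inj) (simp add: mult minus one i)
    moreover have "\<exists>a b. c = of_real a + of_real b * i" for c
      using rep inj by (metis complex.exhaust)
    moreover have "(norm (of_real a + of_real b * i))\<^sup>2 = a\<^sup>2 + b\<^sup>2" for a b
      using norm[of "of_real a + of_real b * i"] rep[of a b] by (metis cmod_power2 complex.sel)
    ultimately show ?thesis by blast
  qed
qed


context banach_over
begin

text \<open>A real norming functional \<open>f\<close> already serves over real scalars. Over
  complex ones it is the real part of the functional g(y) = f(y) - i f(iy), which is complex linear
  with the same bound.\<close>

lemma norming_functional:
  assumes x: "norm x = 1"
  shows "\<exists>g. (\<forall>y z. g (y + z) = g y + g z) \<and> (\<forall>c y. g (smul c y) = c * g y) \<and>
    (\<forall>y. norm (g y) \<le> norm y) \<and> g x = 1"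
proof -
  obtain f where f: "linear f" and bd: "\<And>y. \<bar>f y\<bar> \<le> norm y" and fx: "f x = 1"
    using real_norming_functional[of x] x by auto
  note lin = linear_add[OF f] linear_cmul[OF f] linear_diff[OF f] linear_neg[OF f]
  from scalar_cases[where 'k='k] show ?thesis
  proof (elim disjE exE conjE)
    assume re: "\<forall>c::'k. \<exists>a. c = of_real a"
    have "of_real (f (smul c y)) = c * of_real (f y)" for c y
    proof -
      obtain a where "c = of_real a" using re by blast
      then show ?thesis by (simp add: smul_of_real lin)
    qed
    then show ?thesis
      using bd fx by (intro exI[of _ "\<lambda>y. of_real (f y)"]) (simp add: lin)
  next
    fix i :: 'k
    assume ii: "i * i = - 1" and rep: "\<forall>c. \<exists>a b. c = of_real a + of_real b * i"
      and nrm: "\<forall>a b. (norm (of_real a + of_real b * i))\<^sup>2 = a\<^sup>2 + b\<^sup>2"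
    define g where "g y = of_real (f y) + of_real (- f (smul i y)) * i" for y
    have add: "g (y + z) = g y + g z" for y z
      by (simp add: g_def lin scale_right_distrib algebra_simps)
    have hom: "g (smul c y) = c * g y" for c y
    proof -
      obtain a b where c: "c = of_real a + of_real b * i" using rep by blast
      have 1: "smul c y = a *\<^sub>R y + b *\<^sub>R smul i y"
        by (simp add: c scale_left_distrib smul_of_real flip: scale_scale)
      have ii_mult: "i * (i * u) = - u" for u using ii by (simp flip: mult.assoc)
      have "i * c = of_real a * i - of_real b" by (simp add: c ii_mult algebra_simps)
      then have "smul i (smul c y) = smul (of_real a * i - of_real b) y" by simp
      also have "\<dots> = a *\<^sub>R smul i y - b *\<^sub>R y"
        by (simp add: scale_left_diff_distrib smul_of_real flip: scale_scale)
      finally have 2: "smul i (smul c y) = a *\<^sub>R smul i y - b *\<^sub>R y" .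
      show ?thesis
        unfolding g_def 2 unfolding 1 lin by (simp add: c ii_mult algebra_simps)
    qed
    have bound: "norm (g y) \<le> norm y" for y
    proof (cases "g y = 0")
      case False
      \<comment> \<open>The unimodular factor \<open>l\<close> rotates \<open>g y\<close> onto the
        positive axis, where \<open>g\<close> agrees with its real part \<open>f\<close>.\<close>
      define l where "l = of_real (norm (g y)) / g y"
      have l: "norm l = 1" using False by (simp add: l_def norm_divide)
      have "g (smul l y) = of_real (norm (g y))" using False by (simp add: hom l_def)
      then have "of_real (f (smul l y) - norm (g y)) + of_real (- f (smul i (smul l y))) * i = 0"
        by (simp add: g_def[of "smul l y"] algebra_simps)
      then have "(f (smul l y) - norm (g y))\<^sup>2 + (- f (smul i (smul l y)))\<^sup>2 = 0"
        using nrm by (metis norm_zero zero_power2)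
      then have "norm (g y) = f (smul l y)" by (simp add: sum_power2_eq_zero_iff)
      also have "\<dots> \<le> norm y" using bd[of "smul l y"] by (simp add: norm_smul l)
      finally show ?thesis .
    qed simp
    \<comment> \<open>The real part of \<open>g x\<close> is 1 and its modulus at most 1, so the
      imaginary part vanishes.\<close>
    have "1 + (f (smul i x))\<^sup>2 = (norm (g x))\<^sup>2"
      unfolding g_def using nrm[rule_format, of "f x" "- f (smul i x)"] fx by simp
    also have "\<dots> \<le> 1" using bound[of x] x by (simp add: power_le_one)
    finally have "g x = 1" by (simp add: g_def fx)
    then show ?thesis using add hom bound by blast
  qed
qed

end

section \<open>States and the numerical radius\<close>

lemma onorm_on_upper:
  assumes "\<exists>B. \<forall>x\<in>W. norm (f x) \<le> B * norm x" "x \<in> W"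
  shows "norm (f x) \<le> onorm_on W f * norm x"
proof (cases "norm x = 0")
  case True
  then show ?thesis using assms by fastforce
next
  case False
  obtain B where B: "\<And>x. x \<in> W \<Longrightarrow> norm (f x) \<le> B * norm x" using assms by blast
  have "norm (f x) / norm x \<le> onorm_on W f"
    unfolding onorm_on_def
  proof (rule cSUP_upper)
    show "bdd_above ((\<lambda>x. norm (f x) / norm x) ` W)"
    proof (rule bdd_aboveI2)
      fix y assume "y \<in> W"
      \<comment> \<open>The quotient is 0 at the origin, so its upper bound has to be nonnegative,
        while \<open>B\<close> may be negative if \<open>W\<close> is the zero space.\<close>
      then have "norm (f y) \<le> max B 0 * norm y"
        using B[of y] mult_right_mono[of B "max B 0" "norm y"] by simp
      then show "norm (f y) / norm y \<le> max B 0"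
        by (cases "y = 0") (auto simp: field_simps)
    qed
  qed (rule assms)
  then show ?thesis using False by (simp add: field_simps)
qed

lemma onorm_on_least:
  assumes "W \<noteq> {}" "c \<ge> 0" "\<And>x. x \<in> W \<Longrightarrow> norm (f x) \<le> c * norm x"
  shows "onorm_on W f \<le> c"
  unfolding onorm_on_def
proof (rule cSUP_least)
  fix x assume "x \<in> W"
  then show "norm (f x) / norm x \<le> c"
    using assms(2) assms(3)[of x] by (cases "x = 0") (auto simp: field_simps)
qed fact

lemma onorm_on_eqI:
  assumes "x \<in> W" "norm x = 1" "\<And>x. x \<in> W \<Longrightarrow> norm (f x) \<le> norm x" "norm (f x) = 1"
  shows "onorm_on W f = 1"
proof (rule antisym)
  show "onorm_on W f \<le> 1"
    by (rule onorm_on_least) (use assms in auto)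
  have "norm (f x) \<le> onorm_on W f * norm x"
    by (rule onorm_on_upper) (use assms in \<open>auto intro!: exI[of _ 1]\<close>)
  then show "1 \<le> onorm_on W f" using assms by simp
qed

definition state :: "('k::real_or_complex \<Rightarrow> 'a::banach \<Rightarrow> 'a) \<Rightarrow> 'a set \<Rightarrow> 'a \<Rightarrow> ('a \<Rightarrow> 'k) \<Rightarrow> bool"
  where "state smul W x f \<longleftrightarrow>
    x \<in> W \<and> norm x = 1 \<and> f \<in> dual_on smul W \<and> onorm_on W f = 1 \<and> f x = 1"

lemma numerical_radius_state:
  "numerical_radius smul W T = Sup {norm (f (T x)) | x f. state smul W x f}"
  by (simp add: numerical_radius_def state_def)

lemma state_bound: "state smul W x f \<Longrightarrow> y \<in> W \<Longrightarrow> norm (f y) \<le> norm y"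
  using onorm_on_upper[of W f y] by (auto simp: state_def dual_on_def bounded_linear_on_def)

lemma state_combination:
  assumes "state smul W x f" "y \<in> W" "z \<in> W" "\<And>c z. z \<in> W \<Longrightarrow> smul c z \<in> W"
  shows "f (y + smul c z) = f y + c * f z"
  using assms by (auto simp: state_def dual_on_def bounded_linear_on_def)

definition unit_operator :: "('k::real_or_complex \<Rightarrow> 'a::banach \<Rightarrow> 'a) \<Rightarrow> 'a set \<Rightarrow> ('a \<Rightarrow> 'a) \<Rightarrow> bool"
  where "unit_operator smul W T \<longleftrightarrow> T \<in> operators_on smul W \<and> onorm_on W T = 1"

lemma unit_operator_in: "unit_operator smul W T \<Longrightarrow> x \<in> W \<Longrightarrow> T x \<in> W"
  by (auto simp: unit_operator_def operators_on_def)

lemma unit_operator_bound: "unit_operator smul W T \<Longrightarrow> x \<in> W \<Longrightarrow> norm (T x) \<le> norm x"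
  using onorm_on_upper[of W T x]
  by (auto simp: unit_operator_def operators_on_def bounded_linear_on_def)

lemma unit_operator_scale:
  "unit_operator smul W T \<Longrightarrow> x \<in> W \<Longrightarrow> T (smul c x) = smul c (T x)"
  by (auto simp: unit_operator_def operators_on_def bounded_linear_on_def)

lemma unit_operator_add:
  "unit_operator smul W T \<Longrightarrow> x \<in> W \<Longrightarrow> y \<in> W \<Longrightarrow> T (x + y) = T x + T y"
  by (auto simp: unit_operator_def operators_on_def bounded_linear_on_def)

lemma numerical_radius_upper:
  assumes T: "unit_operator smul W T" and "state smul W x f"
  shows "norm (f (T x)) \<le> numerical_radius smul W T"
  unfolding numerical_radius_state
proof (rule cSup_upper)
  \<comment> \<open>Boundedness of the set is what makes its \<open>Sup\<close> an upper
    bound.\<close>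
  have "norm (f (T x)) \<le> 1" if st: "state smul W x f" for x f
  proof -
    have "x \<in> W" "norm x = 1" using st by (auto simp: state_def)
    then show ?thesis
      using state_bound[OF st unit_operator_in[OF T]] unit_operator_bound[OF T] by fastforce
  qed
  then show "bdd_above {norm (f (T x)) | x f. state smul W x f}" by (auto intro!: bdd_aboveI[of _ 1])
qed (use assms in auto)

text \<open>
  Here \<open>k\<close> bounds the distortion \<open>\<parallel>C\<parallel> \<parallel>C\<^sup>-\<^sup>1\<parallel>\<close> of an operator with \<open>\<parallel>C - I\<parallel> \<le> t\<^sup>2\<close>.
\<close>

definition index_error :: "real \<Rightarrow> real"
  where "index_error t = (let k = (1 + t\<^sup>2) / (1 - t\<^sup>2) in
    (k\<^sup>2 * (1 + t\<^sup>2) - 1) + k * (k * (1 + t\<^sup>2) * (1 + 2 * t\<^sup>2) - 1) / t)"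

text \<open>Since k = 1 + O(t^2), the numerator over \<open>t\<close> is O(t^2), so the whole error
  is O(t).\<close>

lemma index_error_tendsto: "(index_error \<longlongrightarrow> 0) (at_right 0)"
  unfolding index_error_def Let_def by real_asymp

text \<open>Solves the hypothesis for \<open>p\<close>, with 1/(1 - tv) replaced by the larger 1 +
  tv + 2t^2. The coefficient of \<open>v\<close> in the resulting bound for \<open>k * p\<close>
  exceeds 1 by the first summand of \<open>index_error\<close>; the second summand is the part free
  of \<open>v\<close>. The factor \<open>k\<close> on \<open>p\<close> anticipates the normalisation
  of a conjugated operator.\<close>

lemma index_error_estimate:
  fixes t v p :: real
  defines "k \<equiv> (1 + t\<^sup>2) / (1 - t\<^sup>2)"
  assumes t: "0 < t" "t < 1/2" and v: "0 \<le> v" "v \<le> 1" and p: "0 \<le> p"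
    and le: "(1 + t * p) * (1 - t * v) \<le> k * (1 + t\<^sup>2)"
  shows "k * p \<le> v + index_error t"
proof -
  have t2: "t\<^sup>2 < 1" using t by (simp add: power_less_one_iff abs_square_less_1)
  have k: "1 \<le> k" unfolding k_def using t2 by (simp add: field_simps)
  \<comment> \<open>The product (1 - tv)(1 + tv + 2t^2) equals 1 + 2t^2 - t^2 v^2 - 2t^3 v, and each
    subtracted term is at most t^2; the second uses t < 1/2.\<close>
  have "t * t * (v * v) \<le> t * t * 1"
    using v by (intro mult_left_mono) (auto intro: mult_le_one)
  moreover have "2 * (t * v) * (t * t) \<le> 1 * (t * t)"
    using t v mult_mono[of t "1/2" v 1] by (intro mult_right_mono) auto
  ultimately have "1 \<le> (1 - t * v) * (1 + t * v + 2 * t\<^sup>2)"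
    by (simp add: algebra_simps power2_eq_square)
  then have "(1 + t * p) * 1 \<le> (1 + t * p) * ((1 - t * v) * (1 + t * v + 2 * t\<^sup>2))"
    using t p by (intro mult_left_mono) auto
  also have "\<dots> \<le> k * (1 + t\<^sup>2) * (1 + t * v + 2 * t\<^sup>2)"
    unfolding mult.assoc[symmetric] using t v by (intro mult_right_mono le) auto
  finally have "p \<le> (k * (1 + t\<^sup>2) * (1 + t * v + 2 * t\<^sup>2) - 1) / t"
    using t by (simp add: field_simps)
  then have "k * p \<le> k * ((k * (1 + t\<^sup>2) * (1 + t * v + 2 * t\<^sup>2) - 1) / t)"
    using k by (intro mult_left_mono) auto
  also have "\<dots> = k * (k * (1 + t\<^sup>2) * (1 + 2 * t\<^sup>2) - 1) / t + k\<^sup>2 * (1 + t\<^sup>2) * v"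
    using t by (simp add: field_simps power2_eq_square)
  also have "\<dots> \<le> v + index_error t"
  proof -
    have "1 * 1 \<le> k\<^sup>2 * (1 + t\<^sup>2)" using k by (intro mult_mono) auto
    then have "(k\<^sup>2 * (1 + t\<^sup>2) - 1) * v \<le> (k\<^sup>2 * (1 + t\<^sup>2) - 1) * 1"
      using v by (intro mult_left_mono) auto
    then show ?thesis by (simp add: index_error_def k_def[symmetric] algebra_simps)
  qed
  finally show ?thesis .
qed

context banach_over
begin

lemma subspaceD:
  assumes "subspace W"
  shows "x \<in> W \<Longrightarrow> y \<in> W \<Longrightarrow> x + y \<in> W" "x \<in> W \<Longrightarrow> smul c x \<in> W" "x \<in> W \<Longrightarrow> r *\<^sub>R x \<in> W" "0 \<in> W"
  using assms subspace_scale[OF assms, of x "of_real r"]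
  by (auto simp: subspace_add subspace_scale subspace_0 smul_of_real)

lemma unit_vector_exists:
  assumes "subspace W" "W \<noteq> {0}"
  shows "\<exists>x\<in>W. norm x = 1"
proof -
  obtain x where "x \<in> W" "x \<noteq> 0" using assms subspaceD(4) by blast
  then show ?thesis
    using subspaceD(3)[OF assms(1), of x "1 / norm x"] by (intro bexI[of _ "(1 / norm x) *\<^sub>R x"]) auto
qed

text \<open>A norming functional of the whole space keeps norm 1 on \<open>W\<close>, because it
  attains it at \<open>x\<close>, a point of \<open>W\<close>.\<close>

lemma state_exists:
  assumes "subspace W" "x \<in> W" "norm x = 1"
  shows "\<exists>f. state smul W x f"
proof -
  obtain g where g: "\<And>y z. g (y + z) = g y + g z" "\<And>c y. g (smul c y) = c * g y"
    "\<And>y. norm (g y) \<le> norm y" "g x = 1"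
    using norming_functional[OF assms(3)] by blast
  have "g \<in> dual_on smul W"
    using g by (auto simp: dual_on_def bounded_linear_on_def intro!: exI[of _ 1])
  moreover have "onorm_on W g = 1"
    by (rule onorm_on_eqI[of x]) (use assms g in auto)
  ultimately show ?thesis using assms g by (auto simp: state_def)
qed

lemma numerical_radius_nonneg:
  assumes "subspace W" "W \<noteq> {0}" "unit_operator smul W T"
  shows "0 \<le> numerical_radius smul W T"
  by (metis assms norm_ge_zero numerical_radius_upper order_trans state_exists unit_vector_exists)

lemma numerical_radius_least:
  assumes "subspace W" "W \<noteq> {0}"
    and "\<And>x f. state smul W x f \<Longrightarrow> norm (f (T x)) \<le> c"
  shows "numerical_radius smul W T \<le> c"
  unfolding numerical_radius_state
proof (rule cSup_least)
  show "{norm (f (T x)) |x f. state smul W x f} \<noteq> {}"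
    using state_exists[OF assms(1)] unit_vector_exists[OF assms(1,2)] by blast
qed (use assms in auto)

lemma numerical_radius_le_1:
  assumes "subspace W" "W \<noteq> {0}" and T: "unit_operator smul W T"
  shows "numerical_radius smul W T \<le> 1"
proof (rule numerical_radius_least[OF assms(1,2)])
  fix x f assume st: "state smul W x f"
  then have "x \<in> W" "norm x = 1" by (auto simp: state_def)
  then show "norm (f (T x)) \<le> 1"
    using state_bound[OF st unit_operator_in[OF T]] unit_operator_bound[OF T] by fastforce
qed

section \<open>Norm estimates for I + sT\<close>

text \<open>After normalising \<open>x\<close> to \<open>u\<close>, a state \<open>f\<close> at
  \<open>u\<close> sends (I + sT)u to 1 + s f(Tu), of modulus at least 1 - |s| v(T).\<close>

lemma perturbed_identity_lower:
  assumes W: "subspace W" and T: "unit_operator smul W T" and x: "x \<in> W"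
  shows "(1 - norm s * numerical_radius smul W T) * norm x \<le> norm (x + smul s (T x))"
proof (cases "x = 0")
  case False
  define u where "u = (1 / norm x) *\<^sub>R x"
  have u: "u \<in> W" "norm u = 1" using False x by (auto simp: u_def subspaceD[OF W])
  have xu: "x = smul (of_real (norm x)) u" using False by (simp add: u_def smul_of_real)
  obtain f where st: "state smul W u f" using state_exists[OF W u] by blast
  have "1 - norm s * numerical_radius smul W T \<le> 1 - norm s * norm (f (T u))"
    using numerical_radius_upper[OF T st] by (simp add: mult_left_mono)
  also have "\<dots> \<le> norm (1 + s * f (T u))"
    using norm_diff_ineq[of 1 "s * f (T u)"] by (simp add: norm_mult)
  also have "\<dots> = norm (f (u + smul s (T u)))"
    using state_combination[OF st u(1) unit_operator_in[OF T u(1)] subspaceD(2)[OF W]] st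
    by (simp add: state_def)
  also have "\<dots> \<le> norm (u + smul s (T u))"
    using st by (rule state_bound) (auto intro!: subspaceD[OF W] u unit_operator_in[OF T])
  finally have 1: "1 - norm s * numerical_radius smul W T \<le> norm (u + smul s (T u))" .
  have "x + smul s (T x) = smul (of_real (norm x)) (u + smul s (T u))"
    by (subst (1 2) xu) (simp add: unit_operator_scale[OF T u(1)] scale_right_distrib mult.commute)
  then have "norm (x + smul s (T x)) = norm x * norm (u + smul s (T u))"
    by (simp add: norm_smul)
  then show ?thesis using 1 by (simp add: mult.commute mult_left_mono)
qed simp

text \<open>The lower estimate for \<open>- s\<close> at the vector (I + sT)x, combined with (I -
  sT)(I + sT) = I - s^2 T^2.\<close>

lemma perturbed_identity_upper:
  assumes W: "subspace W" and T: "unit_operator smul W T" and x: "x \<in> W"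
  shows "(1 - norm s * numerical_radius smul W T) * norm (x + smul s (T x)) \<le> (1 + (norm s)\<^sup>2) * norm x"
proof -
  note in_T = unit_operator_in[OF T]
  have "(1 - norm (- s) * numerical_radius smul W T) * norm (x + smul s (T x)) \<le>
    norm ((x + smul s (T x)) + smul (- s) (T (x + smul s (T x))))"
    by (rule perturbed_identity_lower[OF W T]) (auto intro!: subspaceD[OF W] x in_T)
  also have "(x + smul s (T x)) + smul (- s) (T (x + smul s (T x))) = x + smul (- (s * s)) (T (T x))"
    by (simp add: unit_operator_add[OF T] unit_operator_scale[OF T] x in_T subspaceD[OF W]
        scale_right_distrib)
  also have "norm \<dots> \<le> norm x + (norm s)\<^sup>2 * norm (T (T x))"
    by (rule norm_triangle_le) (simp add: norm_smul norm_mult power2_eq_square)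
  also have "\<dots> \<le> norm x + (norm s)\<^sup>2 * norm x"
    using unit_operator_bound[OF T in_T[OF x]] unit_operator_bound[OF T x]
    by (intro add_left_mono mult_left_mono) auto
  finally show ?thesis by (simp add: algebra_simps)
qed

section \<open>Continuity of the numerical index\<close>

lemma numerical_index_le:
  assumes "subspace W" "W \<noteq> {0}" "unit_operator smul W T"
  shows "numerical_index smul W \<le> numerical_radius smul W T"
  unfolding numerical_index_def
proof (rule cInf_lower)
  show "bdd_below {numerical_radius smul W T |T. T \<in> operators_on smul W \<and> onorm_on W T = 1}"
    using numerical_radius_nonneg[OF assms(1,2)]
    by (auto intro!: bdd_belowI[of _ 0] simp: unit_operator_def)
qed (use assms in \<open>auto simp: unit_operator_def\<close>)

lemma numerical_index_greatest:
  assumes "subspace W" "W \<noteq> {0}"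
    and "\<And>T. unit_operator smul W T \<Longrightarrow> c \<le> numerical_radius smul W T"
  shows "c \<le> numerical_index smul W"
  unfolding numerical_index_def
proof (rule cInf_greatest)
  \<comment> \<open>The identity has norm 1 on a nonzero space, so the infimum is over a nonempty
    set.\<close>
  obtain x where "x \<in> W" "norm x = 1" using unit_vector_exists[OF assms(1,2)] by blast
  then have "onorm_on W (\<lambda>x. x) = 1" by (intro onorm_on_eqI[of x]) auto
  moreover have "(\<lambda>x. x) \<in> operators_on smul W"
    by (auto simp: operators_on_def bounded_linear_on_def intro!: exI[of _ 1])
  ultimately show "{numerical_radius smul W T |T. T \<in> operators_on smul W \<and> onorm_on W T = 1} \<noteq> {}"
    by blast
qed (use assms in \<open>auto simp: unit_operator_def\<close>)

text \<open>Each norm-one \<open>T\<close> on \<open>W\<close> is transported to its conjugate by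
  \<open>C\<close> on \<open>Z\<close> and rescaled to norm 1. The radius of the result exceeds that
  of \<open>T\<close> by at most the error, and the infimum over \<open>T\<close> gives the
  claim.\<close>

lemma numerical_index_le_of_close:
  assumes W: "subspace W" "W \<noteq> {0}" and Z: "subspace Z" "Z \<noteq> {0}"
    and C: "C \<in> GL smul" "C ` W = Z" and t: "0 < t" "t < 1/2"
    and close: "onorm (\<lambda>x. C x - x) \<le> t\<^sup>2"
  shows "numerical_index smul Z \<le> numerical_index smul W + index_error t"
proof -
  define D where "D = inv C"
  define k where "k = (1 + t\<^sup>2) / (1 - t\<^sup>2)"
  have t2: "0 < 1 - t\<^sup>2" using t by (simp add: abs_square_less_1)
  have k: "k > 0" using t2 by (simp add: k_def add_pos_nonneg)
  have bij: "bij C" and blin: "bounded_linear C" and lin: "Vector_Spaces.linear smul smul C"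
    using C by (auto simp: GL_def)
  interpret C: Vector_Spaces.linear smul smul C by (rule lin)
  have CD: "C (D z) = z" for z unfolding D_def using bij by (simp add: bij_is_surj surj_f_inv_f)
  have DC: "D (C x) = x" for x unfolding D_def using bij by (simp add: bij_is_inj)
  have D_in: "D z \<in> W" if "z \<in> Z" for z using that C(2) DC by auto
  have C_in: "C x \<in> Z" if "x \<in> W" for x using that C(2) by auto
  have D_add: "D (y + z) = D y + D z" for y z by (metis CD DC C.add)
  have D_scale: "D (smul c z) = smul c (D z)" for c z by (metis CD DC C.scale)
  have dist: "norm (C x - x) \<le> t\<^sup>2 * norm x" for x
    using onorm[OF bounded_linear_sub[OF blin bounded_linear_ident], of x] close
    by (meson mult_right_mono norm_ge_zero order_trans)
  have C_up: "norm (C x) \<le> (1 + t\<^sup>2) * norm x" for x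
    using dist[of x] norm_triangle_ineq2[of "C x" x] by (simp add: algebra_simps)
  have C_low: "(1 - t\<^sup>2) * norm x \<le> norm (C x)" for x
    using dist[of x] norm_triangle_ineq3[of "C x" x] by (simp add: algebra_simps)
  have D_up: "norm (D z) \<le> norm z / (1 - t\<^sup>2)" for z
    using C_low[of "D z"] t2 by (simp add: CD field_simps)
  have "numerical_index smul Z - index_error t \<le> numerical_radius smul W T"
    if T: "unit_operator smul W T" for T
  proof -
    define S where "S z = C (T (D z))" for z
    define N where "N = onorm_on Z S"
    note in_T = unit_operator_in[OF T]
    have S_in: "S z \<in> Z" if "z \<in> Z" for z using that by (simp add: S_def C_in D_in in_T)
    have S_add: "S (y + z) = S y + S z" if "y \<in> Z" "z \<in> Z" for y z
      using that by (simp add: S_def D_add unit_operator_add[OF T] D_in C.add)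
    have S_scale: "S (smul c z) = smul c (S z)" if "z \<in> Z" for c z
      using that by (simp add: S_def D_scale unit_operator_scale[OF T] D_in C.scale)
    have "norm (S z) \<le> k * norm z" if "z \<in> Z" for z
    proof -
      have "norm (S z) \<le> (1 + t\<^sup>2) * norm (T (D z))" by (simp add: S_def C_up)
      also have "\<dots> \<le> (1 + t\<^sup>2) * (norm z / (1 - t\<^sup>2))"
        using unit_operator_bound[OF T D_in[OF that]] D_up[of z] by (intro mult_left_mono) auto
      finally show ?thesis by (simp add: k_def)
    qed
    then have SN: "norm (S z) \<le> N * norm z" if "z \<in> Z" for z
      unfolding N_def using that by (intro onorm_on_upper) auto
    obtain z0 where z0: "z0 \<in> Z" "norm z0 = 1" using unit_vector_exists[OF Z] by blast
    have N0: "0 \<le> N" using order_trans[OF norm_ge_zero SN[OF z0(1)]] z0(2) by simp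
    \<comment> \<open>Conjugating back by C^{-1} shows 1 = ||T|| <= k ||S||. Hence \<open>N\<close>
      is nonzero and rescaling by 1/N costs at most the factor \<open>k\<close>.\<close>
    have kN: "1 \<le> k * N"
    proof -
      have "norm (T x) \<le> (k * N) * norm x" if x: "x \<in> W" for x
      proof -
        have "(1 - t\<^sup>2) * norm (T x) \<le> norm (S (C x))" using C_low[of "T x"] by (simp add: S_def DC)
        also have "\<dots> \<le> N * norm (C x)" by (rule SN[OF C_in[OF x]])
        also have "\<dots> \<le> N * ((1 + t\<^sup>2) * norm x)" by (rule mult_left_mono[OF C_up N0])
        finally show ?thesis using t2 by (simp add: k_def field_simps)
      qed
      then have "onorm_on W T \<le> k * N"
        using k N0 subspaceD(4)[OF W(1)] by (intro onorm_on_least) auto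
      then show ?thesis using T by (simp add: unit_operator_def)
    qed
    then have N: "N > 0" using N0 by (cases "N = 0") auto
    have N_inv: "1 / N \<le> k" using kN N by (simp add: field_simps)
    define R where "R z = smul (of_real (1 / N)) (S z)" for z
    have R_norm: "norm (R z) = norm (S z) / N" for z
      using N by (simp add: R_def norm_smul norm_divide)
    have R_le: "norm (R z) \<le> norm z" if "z \<in> Z" for z
      using SN[OF that] N by (simp add: R_norm field_simps)
    have R_op: "R \<in> operators_on smul Z"
      using R_le by (auto simp: operators_on_def bounded_linear_on_def R_def S_add S_scale
          scale_right_distrib mult.commute S_in subspaceD[OF Z(1)] intro!: exI[of _ 1])
    have "onorm_on Z R = 1"
    proof (rule antisym)
      show "onorm_on Z R \<le> 1"
        using R_le z0 by (intro onorm_on_least) auto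
      have R_up: "norm (R z) \<le> onorm_on Z R * norm z" if "z \<in> Z" for z
        using R_le that by (intro onorm_on_upper) (auto intro!: exI[of _ 1])
      have "0 \<le> onorm_on Z R" using order_trans[OF norm_ge_zero R_up[OF z0(1)]] z0(2) by simp
      \<comment> \<open>S = N R on \<open>Z\<close>, so norm of \<open>R\<close> below 1 would
        contradict \<open>N\<close> being the norm of \<open>S\<close>.\<close>
      moreover have "norm (S z) \<le> (N * onorm_on Z R) * norm z" if "z \<in> Z" for z
        using R_up[OF that] N by (simp add: R_norm field_simps)
      ultimately have "N \<le> N * onorm_on Z R"
        unfolding N_def using z0 N N_def by (intro onorm_on_least) auto
      then show "1 \<le> onorm_on Z R" using N by simp
    qed
    with R_op have R: "unit_operator smul Z R" by (simp add: unit_operator_def)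
    let ?v = "numerical_radius smul W T"
    have v: "0 \<le> ?v" "?v \<le> 1"
      using numerical_radius_nonneg[OF W T] numerical_radius_le_1[OF W T] by auto
    have "numerical_radius smul Z R \<le> ?v + index_error t"
    proof (rule numerical_radius_least[OF Z])
      fix z g assume st: "state smul Z z g"
      then have z: "z \<in> Z" "norm z = 1" "g z = 1" by (auto simp: state_def)
      define p where "p = norm (g (S z))"
      \<comment> \<open>The phase aligns \<open>g (S z)\<close> with the positive axis, so that I +
        sS is seen by \<open>g\<close> as 1 + tp; if the value is 0, any phase works.\<close>
      define l where "l = (if g (S z) = 0 then 1 else of_real p / g (S z))"
      define s where "s = of_real t * l"
      have l: "norm l = 1" "l * g (S z) = of_real p" by (auto simp: l_def p_def norm_divide)
      have s: "norm s = t" using t l by (simp add: s_def norm_mult)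
      \<comment> \<open>Makes 1 - t v(T) nonnegative, so the norm inequality below may be multiplied
        by it.\<close>
      have tv: "t * ?v \<le> 1" using t v mult_mono[of t 1 ?v 1] by simp
      have "g (z + smul s (S z)) = of_real (1 + t * p)"
        using state_combination[OF st z(1) S_in[OF z(1)] subspaceD(2)[OF Z(1)]] l
        by (simp add: z s_def mult.assoc)
      then have "\<bar>1 + t * p\<bar> = norm (g (z + smul s (S z)))" by (simp only: norm_of_real)
      also have "\<dots> \<le> norm (z + smul s (S z))"
        using st by (rule state_bound) (auto intro!: subspaceD[OF Z(1)] z S_in)
      \<comment> \<open>I + sS is the conjugate of I + sT, so the comparison costs one bound for
        \<open>C\<close> and one for \<open>D\<close>.\<close>
      also have "z + smul s (S z) = C (D z + smul s (T (D z)))"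
        by (simp add: S_def C.add C.scale CD)
      also have "norm \<dots> \<le> (1 + t\<^sup>2) * norm (D z + smul s (T (D z)))" by (rule C_up)
      finally have "(1 + t * p) * (1 - t * ?v) \<le>
          (1 + t\<^sup>2) * norm (D z + smul s (T (D z))) * (1 - t * ?v)"
        using tv by (intro mult_right_mono) auto
      also have "\<dots> = (1 + t\<^sup>2) * ((1 - t * ?v) * norm (D z + smul s (T (D z))))"
        by (simp add: mult_ac)
      also have "\<dots> \<le> (1 + t\<^sup>2) * ((1 + t\<^sup>2) * norm (D z))"
        using perturbed_identity_upper[OF W(1) T D_in[OF z(1)], of s]
        by (intro mult_left_mono) (auto simp: s)
      also have "\<dots> \<le> (1 + t\<^sup>2) * ((1 + t\<^sup>2) * (1 / (1 - t\<^sup>2)))"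
        using D_up[of z] z by (intro mult_left_mono) auto
      also have "\<dots> = k * (1 + t\<^sup>2)" by (simp add: k_def)
      finally have kp: "k * p \<le> ?v + index_error t"
        unfolding k_def using t v by (intro index_error_estimate) (auto simp: p_def)
      have "g (R z) = of_real (1 / N) * g (S z)"
        using st S_in[OF z(1)] by (auto simp: R_def state_def dual_on_def bounded_linear_on_def)
      then have "norm (g (R z)) = 1 / N * p"
        using N by (simp add: norm_mult norm_divide p_def)
      also have "\<dots> \<le> k * p" by (rule mult_right_mono[OF N_inv]) (simp add: p_def)
      finally show "norm (g (R z)) \<le> ?v + index_error t" using kp by simp
    qed
    then show ?thesis using numerical_index_le[OF Z R] by simp
  qed
  then have "numerical_index smul Z - index_error t \<le> numerical_index smul W"
    by (rule numerical_index_greatest[OF W])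
  then show ?thesis by simp
qed

section \<open>From small openings to close indices\<close>

text \<open>A value strictly below \<open>e\<close> with e <= 1 excludes the default 1, so the
  opening is a true infimum and some \<open>C\<close> comes below \<open>e\<close>.\<close>

lemma opening0_less:
  assumes "opening0 smul W Z < e" "e \<le> 1"
  shows "\<exists>C\<in>GL smul. C ` W = Z \<and> onorm (\<lambda>x. C x - x) \<le> e"
proof -
  have ex: "\<exists>C\<in>GL smul. C ` W = Z" using assms by (auto simp: opening0_def split: if_splits)
  then have "Inf {onorm (\<lambda>x. C x - x) | C. C \<in> GL smul \<and> C ` W = Z} < e"
    using assms by (simp add: opening0_def)
  moreover have "{onorm (\<lambda>x. C x - x) | C. C \<in> GL smul \<and> C ` W = Z} \<noteq> {}" using ex by blast
  ultimately obtain C where "C \<in> GL smul" "C ` W = Z" "onorm (\<lambda>x. C x - x) < e"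
    using cInf_lessD by (smt (verit, best) mem_Collect_eq)
  then show ?thesis by (auto intro: less_imp_le)
qed

lemma GL_image_zero: "C \<in> GL smul \<Longrightarrow> C ` {0} = {0}"
  using bounded_linear.linear linear_0 by (force simp: GL_def)

text \<open>The maximum in the opening supplies operators in both directions, and each gives one
  half of the absolute value.\<close>

lemma numerical_index_diff_le:
  assumes W: "subspace W" and Z: "subspace Z" and t: "0 < t" "t < 1/2" "0 \<le> index_error t"
    and "operator_opening smul W Z < t\<^sup>2"
  shows "\<bar>numerical_index smul W - numerical_index smul Z\<bar> \<le> index_error t"
proof -
  have "t\<^sup>2 \<le> 1" using t by (simp add: power_le_one)
  then obtain C D where C: "C \<in> GL smul" "C ` W = Z" "onorm (\<lambda>x. C x - x) \<le> t\<^sup>2"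
    and D: "D \<in> GL smul" "D ` Z = W" "onorm (\<lambda>x. D x - x) \<le> t\<^sup>2"
    using opening0_less[of W Z "t\<^sup>2"] opening0_less[of Z W "t\<^sup>2"] assms
    by (auto simp: operator_opening_def)
  show ?thesis
  proof (cases "W = {0} \<or> Z = {0}")
    \<comment> \<open>An invertible operator maps only the zero space onto the zero space. So both
      spaces are zero and the unspecified index cancels.\<close>
    case True
    then have "W = Z" using GL_image_zero C(1,2) D(1,2) by metis
    then show ?thesis using t by simp
  next
    case False
    then show ?thesis
      using numerical_index_le_of_close[OF W _ Z _ C(1,2) t(1,2) C(3)]
        numerical_index_le_of_close[OF Z _ W _ D(1,2) t(1,2) D(3)] by (simp add: abs_le_iff)
  qed
qed

end

theorem theoremA:
  fixes smul :: "'k::real_or_complex \<Rightarrow> 'a::banach \<Rightarrow> 'a"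
    and Xn :: "nat \<Rightarrow> 'a set" and X :: "'a set"
  assumes "banach_over smul"
    and "\<And>n. closed_subspace smul (Xn n)" and "closed_subspace smul X"
    and "(\<lambda>n. operator_opening smul (Xn n) X) \<longlonglongrightarrow> 0"
  shows "(\<lambda>n. numerical_index smul (Xn n)) \<longlonglongrightarrow> numerical_index smul X"
proof (rule tendstoI)
  interpret banach_over smul by (rule assms(1))
  fix e :: real assume e: "e > 0"
  \<comment> \<open>The scale \<open>t\<close> is fixed first from \<open>e\<close> alone; then
    \<open>n\<close> is taken large enough for the opening to fall below t^2.\<close>
  have "\<forall>\<^sub>F t in at_right 0. index_error t < e"
    using order_tendstoD(2)[OF index_error_tendsto] e by blast
  moreover have "\<forall>\<^sub>F t in at_right 0. 0 \<le> index_error t"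
    unfolding index_error_def Let_def by real_asymp
  moreover have "\<forall>\<^sub>F t in at_right 0. 0 < t \<and> t < (1/2::real)"
    by (intro eventually_conj) real_asymp+
  ultimately have "\<forall>\<^sub>F t in at_right 0. index_error t < e \<and> 0 \<le> index_error t \<and> 0 < t \<and> t < 1/2"
    by eventually_elim simp
  then obtain t where t: "index_error t < e" "0 \<le> index_error t" "0 < t" "t < 1/2"
    using eventually_happens[of _ "at_right (0::real)"] by auto
  have "\<forall>\<^sub>F n in sequentially. operator_opening smul (Xn n) X < t\<^sup>2"
    using order_tendstoD(2)[OF assms(4)] t by simp
  then show "\<forall>\<^sub>F n in sequentially. dist (numerical_index smul (Xn n)) (numerical_index smul X) < e"
  proof eventually_elim
    case (elim n)
    have "\<bar>numerical_index smul (Xn n) - numerical_index smul X\<bar> \<le> index_error t"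
      using assms(2)[of n] assms(3) t elim
      by (intro numerical_index_diff_le) (auto simp: closed_subspace_def)
    then show ?case using t by (simp add: dist_real_def)
  qed
qed

end
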